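(* The sequences $\mathcal{F}^e(F_6)=(F_i^e \bmod F_6 : i\ge 0)$, where $F_6=8$, satisfy: (i) if $e\ge 1$ is an odd integer, then $\pi(F_6,e)=12$; (ii) $\pi(F_6,2)=6$, and if $e\ge 4$ is an even integer, then $\pi(F_6,e)=3$.
   Context: The Fibonacci numbers are $F_0=0$, $F_1=1$, $F_{i+1}=F_i+F_{i-1}$ for $i\ge 1$. For integers $j\ge 1$, $e\ge 1$, $\mathcal{F}^e(F_j)$ denotes the sequence $(F_i^e \bmod F_j : i\ge 0)$ of residues of $F_i^e$ modulo $F_j$. A sequence $(a_i:i\ge 0)$ is periodic if there is an integer $p\ge 1$, called a period, with $a_{i+p}=a_i$ for all $i\ge 0$. The periodicity $\pi(F_j,e)$ is the minimum period of $\mathcal{F}^e(F_j)$. *)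

theory Defs
  imports "HOL-Number_Theory.Fib"
begin

definition fib_power_residues :: "nat \<Rightarrow> nat \<Rightarrow> nat \<Rightarrow> nat" where
  "fib_power_residues m e i = fib i ^ e mod m"

definition is_period :: "(nat \<Rightarrow> 'a) \<Rightarrow> nat \<Rightarrow> bool" where
  "is_period a p \<longleftrightarrow> p \<ge> 1 \<and> (\<forall>i. a (i + p) = a i)"

(* Only meant for m >= 1, where the sequence does have a period;
   otherwise LEAST may return an unspecified number. *)
definition periodicity :: "nat \<Rightarrow> nat \<Rightarrow> nat" where
  "periodicity m e = (LEAST p. is_period (fib_power_residues m e) p)"

lemma fib_6: "fib 6 = 8"
  by (simp add: numeral_eq_Suc)

end

theory Submission
  imports Defs "HOL-Number_Theory.Cong"
begin

text \<open>
  The periods come from \<open>F\<^sub>i\<^sub>+\<^sub>3 = F\<^sub>i + 2 F\<^sub>i\<^sub>+\<^sub>1\<close> and \<open>F\<^sub>i\<^sub>+\<^sub>6 \<equiv> 5 F\<^sub>i (mod 8)\<close>: since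
  \<open>5\<^sup>2 \<equiv> 1 (mod 8)\<close>, 12 is a period of the residues themselves and 6 is a period of their squares.
  As odd squares are 1 modulo 8, an odd power of an odd number is congruent to that number, while
  an even power \<open>x\<^sup>e\<close> with \<open>e \<ge> 4\<close> depends only on the parity of \<open>x\<close>.
  Minimality needs only the first terms: \<open>F\<^sub>q\<^sub>+\<^sub>1 \<equiv> F\<^sub>q\<^sub>+\<^sub>2 \<equiv> 1 (mod 8)\<close> fails for \<open>0 < q < 12\<close>, and
  for even \<open>e\<close> the residue 0 does not recur before the claimed period.
\<close>

lemma periodicity_eqI:
  assumes "is_period (fib_power_residues m e) p"
    and "\<And>q. is_period (fib_power_residues m e) q \<Longrightarrow> p \<le> q"
  shows "periodicity m e = p"
  unfolding periodicity_def using assms by (rule Least_equality)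

lemma fib_power_residues_cong:
  assumes "[fib i ^ e = fib j ^ e] (mod m)"
  shows "fib_power_residues m e i = fib_power_residues m e j"
  using assms by (simp add: fib_power_residues_def cong_def)

lemma is_period_value:
  "is_period a p \<Longrightarrow> a p = a 0"
  by (metis is_period_def add_0)

lemma odd_power_even_mod_8:
  fixes x :: nat
  assumes "odd x" "even e"
  shows "x ^ e mod 8 = 1"
proof -
  have "x mod 8 \<in> {1, 3, 5, 7}"
    using assms(1) by (simp, presburger)
  then have "(x mod 8)\<^sup>2 mod 8 = 1"
    by auto
  then have "[x\<^sup>2 = 1] (mod 8)"
    by (simp add: cong_def power_mod)
  then have "[(x\<^sup>2) ^ (e div 2) = 1 ^ (e div 2)] (mod 8)"
    by (rule cong_pow)
  then show ?thesis
    using assms(2) by (simp add: cong_def flip: power_mult)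
qed

lemma odd_power_odd_mod_8:
  fixes x :: nat
  assumes "odd x" "odd e"
  shows "x ^ e mod 8 = x mod 8"
proof -
  obtain k where e: "e = Suc k" and "even k"
    using assms(2) by (cases e) auto
  then have "x ^ k mod 8 = 1"
    using odd_power_even_mod_8 assms(1) by blast
  then have "x * x ^ k mod 8 = x * 1 mod 8"
    by (metis mod_mult_right_eq)
  then show ?thesis
    by (simp add: e)
qed

text \<open>The bound 3 comes from 8 = 2^3: three even factors already make the power vanish modulo
  8.\<close>

lemma even_power_mod_8:
  fixes x :: nat
  assumes "even x" "e \<ge> 3"
  shows "x ^ e mod 8 = 0"
proof -
  have "(2::nat) ^ 3 dvd x ^ e"
    using assms by (meson dvd_power_same le_imp_power_dvd dvd_trans)
  then show ?thesis
    by simp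
qed

lemma fib_add_2: "fib (i + 2) = fib (i + 1) + fib i"
  by simp

lemma fib_values:
  "fib 3 = 2" "fib 4 = 3" "fib 5 = 5" "fib 7 = 13" "fib 8 = 21" "fib 9 = 34"
  "fib 10 = 55" "fib 11 = 89" "fib 12 = 144"
proof -
  show 3: "fib 3 = 2" using fib_add_2[of 1] by (simp add: numeral_eq_Suc)
  show 4: "fib 4 = 3" using fib_add_2[of 2] 3 by simp
  show 5: "fib 5 = 5" using fib_add_2[of 3] 3 4 by simp
  show 7: "fib 7 = 13" using fib_add_2[of 5] 5 fib_6 by simp
  show 8: "fib 8 = 21" using fib_add_2[of 6] fib_6 7 by simp
  show 9: "fib 9 = 34" using fib_add_2[of 7] 7 8 by simp
  show 10: "fib 10 = 55" using fib_add_2[of 8] 8 9 by simp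
  show 11: "fib 11 = 89" using fib_add_2[of 9] 9 10 by simp
  show "fib 12 = 144" using fib_add_2[of 10] 10 11 by simp
qed

lemma fib_add_3: "fib (i + 3) = fib i + 2 * fib (i + 1)"
  by (simp add: eval_nat_numeral)

lemma fib_add_6_cong: "[fib (i + 6) = 5 * fib i] (mod 8)"
proof -
  \<comment> \<open>Two steps of 3 give F(i+3) + 2 F(i+4) = F(i) + 4 F(i+1) + 4 F(i+2), and then
    F(i+2) = F(i+1) + F(i).\<close>
  have "fib (i + 6) = 5 * fib i + 8 * fib (i + 1)"
    using fib_add_3[of "i + 3"] fib_add_3[of i] fib_add_3[of "i + 1"] fib_add_2[of i]
    by (simp add: add.assoc)
  then show ?thesis
    by (simp add: cong_def)
qed

text \<open>The factor 25 = 5^2 arises both from two shifts by 6 and from squaring a single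
  shift.\<close>

lemma mult_25_cong: "[25 * x = x] (mod 8)" for x :: nat
proof -
  have "[25 = 1] (mod (8::nat))"
    by (simp add: cong_def)
  then have "[25 * x = 1 * x] (mod 8)"
    by (rule cong_scalar_right)
  then show ?thesis
    by simp
qed

lemma fib_add_12_cong: "[fib (i + 12) = fib i] (mod 8)"
proof -
  have "[fib (i + 6 + 6) = 5 * (5 * fib i)] (mod 8)"
    by (meson fib_add_6_cong cong_trans cong_scalar_left)
  then show ?thesis
    using mult_25_cong[of "fib i"] by (auto intro: cong_trans simp: add.assoc)
qed

lemma periodicity_odd:
  assumes "odd e"
  shows "periodicity 8 e = 12"
proof (rule periodicity_eqI)
  show "is_period (fib_power_residues 8 e) 12"
    by (simp add: is_period_def fib_power_residues_cong cong_pow fib_add_12_cong)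
next
  fix q assume per: "is_period (fib_power_residues 8 e) q"
  have one: "fib (q + j) mod 8 = 1" if "fib j = 1" for j
  proof -
    have "fib (j + q) ^ e mod 8 = 1"
      using per that by (simp add: is_period_def fib_power_residues_def)
    \<comment> \<open>Oddness allows the exponent to be removed: an odd power fixes every odd
      residue modulo 8.\<close>
    moreover have "odd (fib (j + q))"
    proof
      assume "even (fib (j + q))"
      then have "even (fib (j + q) ^ e mod 8)"
        using assms by (simp add: dvd_mod odd_pos)
      with calculation show False
        by simp
    qed
    ultimately show ?thesis
      using odd_power_odd_mod_8 assms by (metis add.commute)
  qed
  have "q \<ge> 1"
    using per by (simp add: is_period_def)
  show "12 \<le> q"
  proof (rule ccontr)
    assume "\<not> 12 \<le> q"
    then have "q \<in> {1, 2, 3, 4, 5, 6, 7, 8, 9, 10, 11}"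
      using \<open>q \<ge> 1\<close> by (simp, presburger)
    \<comment> \<open>Two consecutive terms are needed: F(q+1) alone is 1 modulo 8 for q = 1 and q =
      10 as well, where F(q+2) is 2 and 144.\<close>
    then show False
      using one[of 1] one[of 2] by (auto simp: fib_values fib_6)
  qed
qed

lemma periodicity_2: "periodicity 8 2 = 6"
proof (rule periodicity_eqI)
  have "[(fib (i + 6))\<^sup>2 = (fib i)\<^sup>2] (mod 8)" for i
  proof -
    have "[(fib (i + 6))\<^sup>2 = (5 * fib i)\<^sup>2] (mod 8)"
      by (intro cong_pow fib_add_6_cong)
    then show ?thesis
      using mult_25_cong[of "(fib i)\<^sup>2"] by (auto intro: cong_trans simp: power_mult_distrib)
  qed
  then show "is_period (fib_power_residues 8 2) 6"
    by (simp add: is_period_def fib_power_residues_cong)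
next
  fix q assume per: "is_period (fib_power_residues 8 2) q"
  then have "q \<ge> 1"
    by (simp add: is_period_def)
  have zero: "(fib q)\<^sup>2 mod 8 = 0"
    using is_period_value[OF per] by (simp add: fib_power_residues_def)
  show "6 \<le> q"
  proof (rule ccontr)
    assume "\<not> 6 \<le> q"
    then have "q \<in> {1, 2, 3, 4, 5}"
      using \<open>q \<ge> 1\<close> by auto
    \<comment> \<open>The case q = 3 separates exponent 2 from larger even ones: F(3)^2 = 4 is not 0
      modulo 8, although F(3) is even.\<close>
    then show False
      using zero by (auto simp: fib_values)
  qed
qed

lemma periodicity_even:
  assumes "even e" "e \<ge> 4"
  shows "periodicity 8 e = 3"
proof (rule periodicity_eqI)
  have "fib_power_residues 8 e i = (if even (fib i) then 0 else 1)" for i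
    using assms by (simp add: fib_power_residues_def even_power_mod_8 odd_power_even_mod_8)
  \<comment> \<open>F(i+3) and F(i) differ by 2 F(i+1), so they have the same parity.\<close>
  then show "is_period (fib_power_residues 8 e) 3"
    by (simp add: is_period_def fib_add_3)
next
  fix q assume per: "is_period (fib_power_residues 8 e) q"
  then have "q \<ge> 1"
    by (simp add: is_period_def)
  have zero: "fib q ^ e mod 8 = 0"
    using is_period_value[OF per] assms
    by (simp add: fib_power_residues_def power_0_left)
  show "3 \<le> q"
  proof (rule ccontr)
    assume "\<not> 3 \<le> q"
    then have "q \<in> {1, 2}"
      using \<open>q \<ge> 1\<close> by auto
    \<comment> \<open>F(1) = F(2) = 1, and no power of 1 is 0 modulo 8.\<close>
    then show False
      using zero by (auto simp: fib_values)
  qed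
qed

theorem proposition4:
  shows "(\<forall>e::nat. e \<ge> 1 \<longrightarrow> odd e \<longrightarrow> periodicity (fib 6) e = 12)
    \<and> periodicity (fib 6) 2 = 6
    \<and> (\<forall>e::nat. e \<ge> 4 \<longrightarrow> even e \<longrightarrow> periodicity (fib 6) e = 3)"
  unfolding fib_6 by (simp add: periodicity_odd periodicity_2 periodicity_even)

end
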